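(* Let $m\ge1$ and $1\le c\le m$ be integers and $\gamma\equiv c/m$. Let $i_1,\dots,i_c$ be any particular set of $c$ distinct indices from $\{1,\dots,m\}$. Then both Bernoulli sampling and the two-stage procedure (binomial number of samples followed by uniform sampling without replacement), with inputs $m$ and $c$, pick the set of indices $i_1,\dots,i_c$ (that is, the set of sampled indices is exactly $\{i_1,\dots,i_c\}$) with probability $\gamma^c(1-\gamma)^{m-c}$.
   Context: Bernoulli sampling with inputs $m$ and $c$: each index $t\in\{1,\dots,m\}$ is, independently of the others, sampled with probability $c/m$ and not sampled with probability $1-c/m$. Uniform sampling of $k$ out of $m$ indices without replacement: take a uniformly random permutation $k_1,\dots,k_m$ of $1,\dots,m$; the sampled indices are $k_1,\dots,k_k$, the first $k$ entries of the permutation. Two-stage procedure with inputs $m$ and $c$: set $\gamma\equiv c/m$; sample $\tilde c$ from $\{0,1,\dots,m\}$ with $\Pr[\tilde c=k]=\binom{m}{k}\gamma^k(1-\gamma)^{m-k}$; then sample $\tilde c$ indices from $\{1,\dots,m\}$ uniformly without replacement. The convention $0^0=1$ is used. *)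

theory Defs
  imports "HOL-Probability.Probability" "HOL-Combinatorics.Combinatorics"
begin

text \<open>
  Each sampling procedure is the distribution of the random set of sampled indices, a subset of
  \<^term>\<open>{1..m}\<close>. The inputs are meant to satisfy \<^term>\<open>1 \<le> m\<close> and \<^term>\<open>c \<le> m\<close>, so that \<open>c / m\<close> is a
  probability; \<^const>\<open>bernoulli_pmf\<close> and \<^const>\<open>binomial_pmf\<close> are not meaningful otherwise.
\<close>

text \<open>
  \<^const>\<open>Pi_pmf\<close> is the product distribution, so the indicators of the indices being sampled are
  independent; its argument \<^term>\<open>False\<close> is the value outside \<^term>\<open>{1..m}\<close>.
\<close>

definition bernoulli_sampling :: "nat \<Rightarrow> nat \<Rightarrow> nat set pmf" where
  "bernoulli_sampling m c =
     map_pmf (\<lambda>b. {t \<in> {1..m}. b t})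
       (Pi_pmf {1..m} False (\<lambda>_. bernoulli_pmf (real c / real m)))"

definition uniform_sampling_without_replacement :: "nat \<Rightarrow> nat \<Rightarrow> nat set pmf" where
  "uniform_sampling_without_replacement m k =
     map_pmf (\<lambda>ks. set (take k ks)) (pmf_of_set (permutations_of_set {1..m}))"

text \<open>
  The mass of \<^term>\<open>binomial_pmf m \<gamma>\<close> at \<open>k\<close> is \<open>(m choose k) * \<gamma> ^ k * (1 - \<gamma>) ^ (m - k)\<close>, which is
  zero for \<open>k > m\<close>; \<open>0 ^ 0 = 1\<close> holds for the library's power.
\<close>

definition two_stage_sampling :: "nat \<Rightarrow> nat \<Rightarrow> nat set pmf" where
  "two_stage_sampling m c =
     bind_pmf (binomial_pmf m (real c / real m)) (uniform_sampling_without_replacement m)"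

end

theory Submission
  imports Defs
begin

text \<open>
  A set \<open>S\<close> of \<open>c\<close> indices is the set of the first \<open>c\<close> entries of exactly \<open>c! (m - c)!\<close> of the \<open>m!\<close>
  permutations, so sampling \<open>c\<close> indices without replacement yields \<open>S\<close> with probability
  \<open>1 / (m choose c)\<close>, and sampling any other number of indices never yields \<open>S\<close>. In the two-stage
  procedure this cancels the binomial coefficient in the probability of drawing \<open>c\<close> samples.
\<close>

text \<open>Within the support, only the indicator of \<open>S\<close> is mapped to
  \<open>S\<close>. Its mass is a product over \<open>A\<close> with factor \<open>p\<close> on
  \<open>S\<close> and \<open>1 - p\<close> on \<open>A - S\<close>.\<close>

lemma pmf_map_Collect_Pi_pmf_bernoulli:
  assumes "finite A" and "S \<subseteq> A" and "0 \<le> p" and "p \<le> 1"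
  shows "pmf (map_pmf (\<lambda>b. {t \<in> A. b t}) (Pi_pmf A False (\<lambda>_. bernoulli_pmf p))) S
         = p ^ card S * (1 - p) ^ (card A - card S)"
proof -
  let ?P = "Pi_pmf A False (\<lambda>_. bernoulli_pmf p)"
  let ?b = "\<lambda>t. t \<in> S"
  have eq: "f = ?b" if "f \<in> set_pmf ?P" and "{t \<in> A. f t} = S" for f
  proof
    fix t
    show "f t = (t \<in> S)"
      \<comment> \<open>On \<open>A\<close> the preimage condition fixes \<open>f\<close>; outside
        \<open>A\<close> the support forces the default \<open>False\<close>, which agrees with
        \<open>t \<in> S\<close> because \<open>S \<subseteq> A\<close>.\<close>
      using that set_Pi_pmf_subset[OF \<open>finite A\<close>, of False "\<lambda>_. bernoulli_pmf p"]
      by (cases "t \<in> A") auto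
  qed
  have "{t \<in> A. ?b t} = S"
    using \<open>S \<subseteq> A\<close> by auto
  \<comment> \<open>The preimage may also contain functions that are true somewhere outside
    \<open>A\<close>, but these have mass zero.\<close>
  then have "measure_pmf.prob ?P ((\<lambda>b. {t \<in> A. b t}) -` {S}) = measure_pmf.prob ?P {?b}"
    using eq by (intro measure_prob_cong_0) (auto simp: pmf_eq_0_set_pmf)
  then have "pmf (map_pmf (\<lambda>b. {t \<in> A. b t}) ?P) S = pmf ?P ?b"
    by (simp add: pmf_map measure_pmf_single)
  also have "\<dots> = (\<Prod>t\<in>A. pmf (bernoulli_pmf p) (t \<in> S))"
    using \<open>S \<subseteq> A\<close> by (intro pmf_Pi'[OF \<open>finite A\<close>]) auto
  also have "\<dots> = (\<Prod>t\<in>A. if t \<in> S then p else 1 - p)"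
    using assms by (intro prod.cong) auto
  also have "\<dots> = p ^ card S * (1 - p) ^ card (A - S)"
    using assms by (simp add: prod.If_cases Int_absorb1 Diff_eq)
  finally show ?thesis
    using assms by (simp add: card_Diff_subset finite_subset)
qed

text \<open>Cutting after \<open>card S\<close> entries splits each such permutation uniquely into a
  permutation of \<open>S\<close> followed by one of \<open>A - S\<close>.\<close>

lemma card_permutations_of_set_take:
  fixes S :: "'a set"
  assumes "finite A" and "S \<subseteq> A"
  shows "card {xs \<in> permutations_of_set A. set (take (card S) xs) = S}
         = fact (card S) * fact (card A - card S)"
proof -
  have fin: "finite S" "finite (A - S)"
    using assms finite_subset by auto
  have "bij_betw (\<lambda>(xs, ys). xs @ ys) (permutations_of_set S \<times> permutations_of_set (A - S))
          {xs \<in> permutations_of_set A. set (take (card S) xs) = S}"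
  proof (rule bij_betw_byWitness[where f' = "\<lambda>xs. (take (card S) xs, drop (card S) xs)"])
    show "(\<lambda>(xs, ys). xs @ ys) ` (permutations_of_set S \<times> permutations_of_set (A - S))
          \<subseteq> {xs \<in> permutations_of_set A. set (take (card S) xs) = S}"
      using assms by (auto simp: permutations_of_set_def distinct_card)
    \<comment> \<open>Distinctness keeps the two pieces disjoint, so the tail lists exactly the
      complement of the head.\<close>
    have "set (drop (card S) xs) = set xs - set (take (card S) xs)" if "distinct xs" for xs :: "'a list"
      using that set_take_disj_set_drop_if_distinct[of xs "card S" "card S"]
        set_append[of "take (card S) xs" "drop (card S) xs"] by auto
    then show "(\<lambda>xs. (take (card S) xs, drop (card S) xs)) `
            {xs \<in> permutations_of_set A. set (take (card S) xs) = S}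
          \<subseteq> permutations_of_set S \<times> permutations_of_set (A - S)"
      by (auto simp: permutations_of_set_def)
  qed (auto simp: permutations_of_set_def distinct_card)
  then have "card {xs \<in> permutations_of_set A. set (take (card S) xs) = S}
      = card (permutations_of_set S \<times> permutations_of_set (A - S))"
    by (rule bij_betw_same_card[symmetric])
  then show ?thesis
    using fin assms by (simp add: card_cartesian_product card_Diff_subset)
qed

lemma pmf_uniform_sampling_without_replacement:
  assumes "S \<subseteq> {1..m}" and "k \<le> m"
  shows "pmf (uniform_sampling_without_replacement m k) S
         = (if k = card S then 1 / real (m choose k) else 0)"
proof (cases "k = card S")
  case True
  have "pmf (uniform_sampling_without_replacement m k) S
      = real (card {xs \<in> permutations_of_set {1..m}. set (take k xs) = S}) / fact m"
    by (simp add: uniform_sampling_without_replacement_def pmf_map measure_pmf_of_set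
        Int_def vimage_def)
  also have "\<dots> = fact k * fact (m - k) / fact m"
    using card_permutations_of_set_take[OF _ assms(1)] True by simp
  also have "\<dots> = 1 / real (m choose k)"
    using \<open>k \<le> m\<close> by (simp add: binomial_fact)
  finally show ?thesis
    using True by simp
next
  case False
  \<comment> \<open>Every outcome has exactly \<open>k\<close> elements, so a set of another size
    lies outside the support.\<close>
  have "card (set (take k xs)) = k" if "xs \<in> permutations_of_set {1..m}" for xs
    using that \<open>k \<le> m\<close> length_finite_permutations_of_set[OF that]
    by (simp add: permutations_of_set_def distinct_card)
  then have "S \<notin> set_pmf (uniform_sampling_without_replacement m k)"
    using False by (auto simp: uniform_sampling_without_replacement_def)
  then show ?thesis
    using False by (simp add: set_pmf_iff)
qed

lemma pmf_bind_binomial_uniform_sampling: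
  assumes "S \<subseteq> {1..m}" and "0 \<le> p" and "p \<le> 1"
  shows "pmf (bind_pmf (binomial_pmf m p) (uniform_sampling_without_replacement m)) S
         = p ^ card S * (1 - p) ^ (m - card S)"
proof -
  let ?U = "uniform_sampling_without_replacement m"
  have le: "card S \<le> m"
    using card_mono[OF _ assms(1)] by simp
  have "pmf (bind_pmf (binomial_pmf m p) ?U) S
      = (\<Sum>k\<le>m. pmf (?U k) S * pmf (binomial_pmf m p) k)"
    \<comment> \<open>The binomial support lies in \<open>{..m}\<close>, which makes the integral a
      finite sum; the case split covers \<open>p = 0\<close> and \<open>p = 1\<close>, where the
      support is a single point.\<close>
    unfolding pmf_bind using assms
    by (intro integral_measure_pmf_real) (auto simp: set_pmf_binomial_eq split: if_splits)
  also have "\<dots> = (\<Sum>k\<le>m. if k = card S then pmf (binomial_pmf m p) k / real (m choose k) else 0)"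
    using assms by (intro sum.cong) (auto simp: pmf_uniform_sampling_without_replacement)
  also have "\<dots> = pmf (binomial_pmf m p) (card S) / real (m choose card S)"
    using le by simp
  also have "\<dots> = p ^ card S * (1 - p) ^ (m - card S)"
    using assms le by simp
  finally show ?thesis .
qed

theorem theorem3p4:
  fixes m c :: nat and \<gamma> :: real and i :: "nat \<Rightarrow> nat"
  assumes "1 \<le> m" and "1 \<le> c" and "c \<le> m"
    and "\<gamma> = real c / real m"
    and "inj_on i {1..c}" and "i ` {1..c} \<subseteq> {1..m}"
  shows "measure_pmf.prob (bernoulli_sampling m c) {S. S = i ` {1..c}} = \<gamma> ^ c * (1 - \<gamma>) ^ (m - c) \<and>
         measure_pmf.prob (two_stage_sampling m c) {S. S = i ` {1..c}} = \<gamma> ^ c * (1 - \<gamma>) ^ (m - c)"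
proof -
  have "0 \<le> \<gamma>" "\<gamma> \<le> 1"
    using assms by auto
  \<comment> \<open>Injectivity of \<open>i\<close> turns the exponents \<open>card S\<close> of the
    lemmas into \<open>c\<close>.\<close>
  moreover have "card (i ` {1..c}) = c"
    using assms(5) by (simp add: card_image)
  ultimately show ?thesis
    using pmf_map_Collect_Pi_pmf_bernoulli[OF _ assms(6), of \<gamma>]
      pmf_bind_binomial_uniform_sampling[OF assms(6), of \<gamma>]
    by (simp add: bernoulli_sampling_def two_stage_sampling_def measure_pmf_single
        flip: assms(4))
qed

end
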